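(* Let $G$ be a group with center $\mathrm{Z}(G)$. Then there is an embedding (injective homomorphism) of groups $\mathrm{Z}(G)\rtimes\operatorname{Aut}(G)\hookrightarrow\operatorname{Aut}(\operatorname{Conj}(G))$.
   Context: A quandle is a set $X$ with a binary operation $*$ such that: (i) $a*a=a$ for all $a\in X$; (ii) for any $a,b\in X$ there is a unique $c\in X$ with $a=c*b$; (iii) $(a*b)*c=(a*c)*(b*c)$ for all $a,b,c\in X$. An automorphism of a quandle $X$ is a bijection $f:X\to X$ with $f(a*b)=f(a)*f(b)$; these form the group $\operatorname{Aut}(X)$ under composition. For a group $G$, the conjugation quandle $\operatorname{Conj}(G)$ is the set $G$ with operation $a*b=b^{-1}ab$. $\operatorname{Aut}(G)$ is the group of group automorphisms of $G$, acting on $\mathrm{Z}(G)$ in the natural way, so that in $\mathrm{Z}(G)\rtimes\operatorname{Aut}(G)$ one has $(a_1,f_1)(a_2,f_2)=(a_1f_1(a_2),f_1f_2)$. *)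

theory Defs
  imports "HOL-Algebra.Bij"
begin

record 'a quandle = "'a partial_object" +
  qop :: "'a \<Rightarrow> 'a \<Rightarrow> 'a" (infixl \<open>\<triangleleft>\<index>\<close> 70)

locale quandle =
  fixes X :: "('a, 'b) quandle_scheme" (structure)
  assumes closed: "\<lbrakk>a \<in> carrier X; b \<in> carrier X\<rbrakk> \<Longrightarrow> a \<triangleleft> b \<in> carrier X"
    and idem: "a \<in> carrier X \<Longrightarrow> a \<triangleleft> a = a"
    and right_div: "\<lbrakk>a \<in> carrier X; b \<in> carrier X\<rbrakk> \<Longrightarrow> \<exists>!c. c \<in> carrier X \<and> a = c \<triangleleft> b"
    and right_distrib: "\<lbrakk>a \<in> carrier X; b \<in> carrier X; c \<in> carrier X\<rbrakk>
      \<Longrightarrow> (a \<triangleleft> b) \<triangleleft> c = (a \<triangleleft> c) \<triangleleft> (b \<triangleleft> c)"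

text \<open>As for \<^const>\<open>auto\<close> and \<^const>\<open>AutoGroup\<close>, automorphisms are represented by
  extensional functions, so that each one has a unique representative.\<close>

definition quandle_auto :: "('a, 'b) quandle_scheme \<Rightarrow> ('a \<Rightarrow> 'a) set"
  where "quandle_auto X =
    {f \<in> Bij (carrier X).
      \<forall>a\<in>carrier X. \<forall>b\<in>carrier X. f (a \<triangleleft>\<^bsub>X\<^esub> b) = f a \<triangleleft>\<^bsub>X\<^esub> f b}"

definition QuandleAutoGroup :: "('a, 'b) quandle_scheme \<Rightarrow> ('a \<Rightarrow> 'a) monoid"
  where "QuandleAutoGroup X = BijGroup (carrier X) \<lparr>carrier := quandle_auto X\<rparr>"

definition Conj :: "('a, 'b) monoid_scheme \<Rightarrow> 'a quandle"
  where "Conj G =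
    \<lparr>carrier = carrier G, qop = (\<lambda>a b. inv\<^bsub>G\<^esub> b \<otimes>\<^bsub>G\<^esub> a \<otimes>\<^bsub>G\<^esub> b)\<rparr>"

definition center :: "('a, 'b) monoid_scheme \<Rightarrow> 'a set"
  where "center G =
    {z \<in> carrier G. \<forall>g\<in>carrier G. z \<otimes>\<^bsub>G\<^esub> g = g \<otimes>\<^bsub>G\<^esub> z}"

abbreviation CenterGroup :: "('a, 'b) monoid_scheme \<Rightarrow> ('a, 'b) monoid_scheme"
  where "CenterGroup G \<equiv> G\<lparr>carrier := center G\<rparr>"

definition SemidirectProduct ::
  "('n, 'b) monoid_scheme \<Rightarrow> ('h, 'c) monoid_scheme \<Rightarrow> ('h \<Rightarrow> 'n \<Rightarrow> 'n) \<Rightarrow> ('n \<times> 'h) monoid"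
  where "SemidirectProduct N H \<alpha> =
    \<lparr>carrier = carrier N \<times> carrier H,
     mult = (\<lambda>(a\<^sub>1, f\<^sub>1) (a\<^sub>2, f\<^sub>2). (a\<^sub>1 \<otimes>\<^bsub>N\<^esub> \<alpha> f\<^sub>1 a\<^sub>2, f\<^sub>1 \<otimes>\<^bsub>H\<^esub> f\<^sub>2)),
     one = (\<one>\<^bsub>N\<^esub>, \<one>\<^bsub>H\<^esub>)\<rparr>"

lemma (in group) quandle_Conj: "quandle (Conj G)"
proof
  fix a b assume ab: "a \<in> carrier (Conj G)" "b \<in> carrier (Conj G)"
  then have G: "a \<in> carrier G" "b \<in> carrier G" by (simp_all add: Conj_def)
  show "a \<triangleleft>\<^bsub>Conj G\<^esub> b \<in> carrier (Conj G)"
    using G by (simp add: Conj_def)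
  show "\<exists>!c. c \<in> carrier (Conj G) \<and> a = c \<triangleleft>\<^bsub>Conj G\<^esub> b"
  proof (rule ex1I[of _ "b \<otimes> a \<otimes> inv b"])
    show "b \<otimes> a \<otimes> inv b \<in> carrier (Conj G) \<and> a = (b \<otimes> a \<otimes> inv b) \<triangleleft>\<^bsub>Conj G\<^esub> b"
      using G by (simp add: Conj_def m_assoc inv_solve_left)
    show "c = b \<otimes> a \<otimes> inv b" if "c \<in> carrier (Conj G) \<and> a = c \<triangleleft>\<^bsub>Conj G\<^esub> b" for c
      using that G by (simp add: Conj_def m_assoc inv_solve_left)
        (metis inv_closed inv_solve_right m_assoc m_closed r_inv r_one l_inv l_one inv_inv)
  qed
next
  fix a assume "a \<in> carrier (Conj G)"
  then show "a \<triangleleft>\<^bsub>Conj G\<^esub> a = a" by (simp add: Conj_def)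
next
  fix a b c assume "a \<in> carrier (Conj G)" "b \<in> carrier (Conj G)" "c \<in> carrier (Conj G)"
  then have G: "a \<in> carrier G" "b \<in> carrier G" "c \<in> carrier G" by (simp_all add: Conj_def)
  have canc: "c \<otimes> (inv c \<otimes> x) = x" if "x \<in> carrier G" for x
    using that G by (simp add: m_assoc[symmetric])
  show "a \<triangleleft>\<^bsub>Conj G\<^esub> b \<triangleleft>\<^bsub>Conj G\<^esub> c
      = a \<triangleleft>\<^bsub>Conj G\<^esub> c \<triangleleft>\<^bsub>Conj G\<^esub> (b \<triangleleft>\<^bsub>Conj G\<^esub> c)"
    using G by (simp add: Conj_def m_assoc inv_mult_group canc)
qed

end

theory Submission
  imports Defs
begin

text \<open>
  The embedding sends \<open>(a, f)\<close> to the affine map \<open>x \<mapsto> a \<otimes> f x\<close>. Left translation by a central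
  element \<open>a\<close> is an automorphism of the conjugation quandle: in \<open>(a y)\<inverse> (a x) (a y)\<close> the
  central factors commute past everything, two of the three cancel, and \<open>a (y\<inverse> x y)\<close> is left. A group
  automorphism preserves conjugation as well, so \<open>x \<mapsto> a \<otimes> f x\<close> is a composite of two quandle
  automorphisms (\<open>affine_quandle_auto\<close>).

  Since \<open>a\<^sub>1 f\<^sub>1(a\<^sub>2 f\<^sub>2(x)) = (a\<^sub>1 f\<^sub>1(a\<^sub>2)) (f\<^sub>1 f\<^sub>2)(x)\<close>, composition of these maps is exactly the
  multiplication of the semidirect product. The map is injective because \<open>a\<close> is recovered as the
  value at \<open>\<one>\<close>, after which \<open>f\<close> is recovered by cancelling \<open>a\<close> (\<open>inj_on_affine\<close>).

  The homomorphism property between groups also requires that both sides are groups: the quandle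
  automorphisms form a subgroup of all bijections of the carrier (\<open>group_QuandleAutoGroup\<close>),
  and the group automorphisms act on the centre by group endomorphisms, which makes the
  semidirect product a group (\<open>group_SemidirectProduct\<close>).
\<close>

section \<open>The automorphism group of a quandle\<close>

lemma (in quandle) subgroup_quandle_auto:
  "subgroup (quandle_auto X) (BijGroup (carrier X))"
proof (rule subgroup.intro)
  show "quandle_auto X \<subseteq> carrier (BijGroup (carrier X))"
    by (auto simp: quandle_auto_def BijGroup_def)
next
  fix f g assume f: "f \<in> quandle_auto X" and g: "g \<in> quandle_auto X"
  then have "g \<in> carrier X \<rightarrow> carrier X"
    by (simp add: quandle_auto_def Bij_imp_funcset)
  with f g show "f \<otimes>\<^bsub>BijGroup (carrier X)\<^esub> g \<in> quandle_auto X"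
    by (auto simp: quandle_auto_def BijGroup_def compose_Bij compose_eq closed Pi_iff)
next
  show "\<one>\<^bsub>BijGroup (carrier X)\<^esub> \<in> quandle_auto X"
    by (simp add: quandle_auto_def BijGroup_def id_Bij closed)
next
  fix f assume f: "f \<in> quandle_auto X"
  then have bij: "f \<in> Bij (carrier X)"
    by (simp add: quandle_auto_def)
  have "inv_into (carrier X) f (a \<triangleleft> b) = inv_into (carrier X) f a \<triangleleft> inv_into (carrier X) f b"
    if "a \<in> carrier X" "b \<in> carrier X" for a b
    using f that by (intro Bij_inv_into_lemma) (auto simp: quandle_auto_def closed)
  with bij show "inv\<^bsub>BijGroup (carrier X)\<^esub> f \<in> quandle_auto X"
    by (simp add: inv_BijGroup quandle_auto_def restrict_inv_into_Bij closed)
qed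

lemma (in quandle) group_QuandleAutoGroup: "group (QuandleAutoGroup X)"
  unfolding QuandleAutoGroup_def
  by (rule subgroup.subgroup_is_group[OF subgroup_quandle_auto group_BijGroup])

section \<open>Semidirect products\<close>

lemma group_SemidirectProduct:
  assumes "group N" and "group H"
    and hom: "\<And>h. h \<in> carrier H \<Longrightarrow> \<alpha> h \<in> hom N N"
    and act_one: "\<And>n. n \<in> carrier N \<Longrightarrow> \<alpha> \<one>\<^bsub>H\<^esub> n = n"
    and act_mult: "\<And>g h n. \<lbrakk>g \<in> carrier H; h \<in> carrier H; n \<in> carrier N\<rbrakk>
      \<Longrightarrow> \<alpha> (g \<otimes>\<^bsub>H\<^esub> h) n = \<alpha> g (\<alpha> h n)"
  shows "group (SemidirectProduct N H \<alpha>)"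
proof -
  interpret N: group N by fact
  interpret H: group H by fact
  note act_closed = hom_in_carrier[OF hom]
  note act_hom = hom_mult[OF hom]
  show ?thesis
  proof (rule groupI)
    fix x assume "x \<in> carrier (SemidirectProduct N H \<alpha>)"
    then obtain a h where x: "x = (a, h)" and a: "a \<in> carrier N" and h: "h \<in> carrier H"
      by (auto simp: SemidirectProduct_def)
    \<comment> \<open>Forced by the second component, which must be \<open>inv h\<close>: the first must then cancel
      \<open>\<alpha> (inv h) a\<close>, and does so because \<open>\<alpha> (inv h)\<close> is a homomorphism.\<close>
    let ?y = "(\<alpha> (inv\<^bsub>H\<^esub> h) (inv\<^bsub>N\<^esub> a), inv\<^bsub>H\<^esub> h)"
    have "\<alpha> (inv\<^bsub>H\<^esub> h) (inv\<^bsub>N\<^esub> a) \<otimes>\<^bsub>N\<^esub> \<alpha> (inv\<^bsub>H\<^esub> h) a = \<one>\<^bsub>N\<^esub>"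
      using a h act_hom[of "inv\<^bsub>H\<^esub> h" "inv\<^bsub>N\<^esub> a" a] hom_one[OF hom \<open>group N\<close> \<open>group N\<close>]
      by simp
    with a h x act_closed
    show "\<exists>y\<in>carrier (SemidirectProduct N H \<alpha>).
        y \<otimes>\<^bsub>SemidirectProduct N H \<alpha>\<^esub> x = \<one>\<^bsub>SemidirectProduct N H \<alpha>\<^esub>"
      by (intro bexI[of _ ?y]) (auto simp: SemidirectProduct_def)
  qed (auto simp: SemidirectProduct_def act_closed act_hom act_one act_mult N.m_assoc H.m_assoc)
qed

section \<open>Automorphisms acting on the centre\<close>

lemma center_closed: "z \<in> center G \<Longrightarrow> z \<in> carrier G"
  by (simp add: center_def)

lemma center_commute: "\<lbrakk>z \<in> center G; g \<in> carrier G\<rbrakk> \<Longrightarrow> z \<otimes>\<^bsub>G\<^esub> g = g \<otimes>\<^bsub>G\<^esub> z"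
  by (simp add: center_def)

lemma centerI:
  assumes "z \<in> carrier G" and "\<And>g. g \<in> carrier G \<Longrightarrow> z \<otimes>\<^bsub>G\<^esub> g = g \<otimes>\<^bsub>G\<^esub> z"
  shows "z \<in> center G"
  using assms unfolding center_def by blast

lemma (in group) subgroup_center: "subgroup (center G) G"
proof (rule subgroupI)
  show "center G \<subseteq> carrier G"
    by (auto dest: center_closed)
  have "\<one> \<in> center G"
    by (rule centerI) simp_all
  then show "center G \<noteq> {}"
    by blast
next
  fix z assume z: "z \<in> center G"
  note zG = center_closed[OF z]
  show "inv z \<in> center G"
  proof (rule centerI)
    fix g assume g: "g \<in> carrier G"
    have "inv z \<otimes> g = inv (inv g \<otimes> z)"
      using g zG by (simp add: inv_mult_group)
    also have "\<dots> = inv (z \<otimes> inv g)"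
      using g by (simp only: center_commute[OF z] inv_closed)
    also have "\<dots> = g \<otimes> inv z"
      using g zG by (simp add: inv_mult_group)
    finally show "inv z \<otimes> g = g \<otimes> inv z" .
  qed (simp add: zG)
next
  fix z w assume z: "z \<in> center G" and w: "w \<in> center G"
  note zG = center_closed[OF z] and wG = center_closed[OF w]
  show "z \<otimes> w \<in> center G"
  proof (rule centerI)
    fix g assume g: "g \<in> carrier G"
    have "z \<otimes> w \<otimes> g = z \<otimes> (g \<otimes> w)"
      using g zG wG by (simp add: m_assoc center_commute[OF w g])
    also have "\<dots> = (g \<otimes> z) \<otimes> w"
      using g zG wG by (simp add: m_assoc[symmetric] center_commute[OF z g])
    also have "\<dots> = g \<otimes> (z \<otimes> w)"
      using g zG wG by (rule m_assoc)
    finally show "z \<otimes> w \<otimes> g = g \<otimes> (z \<otimes> w)" .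
  qed (simp add: zG wG)
qed

text \<open>
  Surjectivity of \<open>f\<close> matters here: commuting with every \<open>f g\<close> then means commuting with
  every element of the group.
\<close>

lemma auto_center:
  assumes f: "f \<in> auto G" and z: "z \<in> center G"
  shows "f z \<in> center G"
proof -
  have hom: "f \<in> hom G G" and surj: "f ` carrier G = carrier G"
    using f by (auto simp: auto_def Bij_def bij_betw_def)
  note zG = center_closed[OF z]
  show ?thesis
  proof (rule centerI)
    show "f z \<in> carrier G"
      by (rule hom_in_carrier[OF hom zG])
    fix g assume "g \<in> carrier G"
    then have "g \<in> f ` carrier G"
      by (simp only: surj)
    then obtain g' where g: "g = f g'" and g': "g' \<in> carrier G"
      by (rule imageE)
    show "f z \<otimes>\<^bsub>G\<^esub> g = g \<otimes>\<^bsub>G\<^esub> f z"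
      unfolding g hom_mult[OF hom zG g', symmetric] hom_mult[OF hom g' zG, symmetric]
      by (simp only: center_commute[OF z g'])
  qed
qed

lemma AutoGroup_simps:
  "carrier (AutoGroup G) = auto G"
  "\<one>\<^bsub>AutoGroup G\<^esub> = (\<lambda>x\<in>carrier G. x)"
  "\<lbrakk>f \<in> auto G; g \<in> auto G\<rbrakk> \<Longrightarrow> f \<otimes>\<^bsub>AutoGroup G\<^esub> g = compose (carrier G) f g"
  by (auto simp: AutoGroup_def BijGroup_def auto_def)

lemma (in group) group_SemidirectProduct_center_auto:
  "group (SemidirectProduct (CenterGroup G) (AutoGroup G) (\<lambda>f a. f a))"
proof (rule group_SemidirectProduct)
  show "group (CenterGroup G)"
    by (rule subgroup.subgroup_is_group[OF subgroup_center is_group])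
  show "group (AutoGroup G)"
    by (rule AutoGroup)
  show "f \<in> hom (CenterGroup G) (CenterGroup G)" if "f \<in> carrier (AutoGroup G)" for f
    using that auto_center[of f G]
    by (auto simp: AutoGroup_simps auto_def hom_def center_closed)
qed (auto simp: AutoGroup_simps center_closed compose_eq)

section \<open>Affine maps as quandle automorphisms\<close>

text \<open>
  This is where centrality is used twice: conjugating by \<open>a \<otimes> y\<close> is the same as conjugating by
  \<open>y\<close>, and conjugation fixes \<open>a\<close>.
\<close>

lemma (in group) conj_central_mult:
  assumes "a \<in> center G" and x: "x \<in> carrier G" and y: "y \<in> carrier G"
  shows "inv (a \<otimes> y) \<otimes> (a \<otimes> x) \<otimes> (a \<otimes> y) = a \<otimes> (inv y \<otimes> x \<otimes> y)"
proof -
  note aG = center_closed[OF assms(1)] and comm = center_commute[OF assms(1)]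
  have "inv (a \<otimes> y) \<otimes> (a \<otimes> x) \<otimes> (a \<otimes> y) = inv y \<otimes> (inv a \<otimes> (a \<otimes> (x \<otimes> (a \<otimes> y))))"
    using aG x y by (simp add: inv_mult_group m_assoc)
  also have "\<dots> = inv y \<otimes> (x \<otimes> (a \<otimes> y))"
    using aG x y by (simp add: m_assoc[symmetric])
  also have "\<dots> = (inv y \<otimes> x \<otimes> y) \<otimes> a"
    using aG x y by (simp add: comm[OF y] m_assoc)
  also have "\<dots> = a \<otimes> (inv y \<otimes> x \<otimes> y)"
    using x y by (intro comm[symmetric]) simp
  finally show ?thesis .
qed

lemma (in group) affine_quandle_auto:
  assumes a: "a \<in> center G" and f: "f \<in> auto G"
  shows "(\<lambda>x\<in>carrier G. a \<otimes> f x) \<in> quandle_auto (Conj G)"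
proof -
  note aG = center_closed[OF a]
  have hom: "f \<in> hom G G" and bij_f: "bij_betw f (carrier G) (carrier G)"
    using f by (auto simp: auto_def Bij_def)
  interpret f: group_hom G G f
    using hom by unfold_locales
  have "bij_betw (\<lambda>x. a \<otimes> x) (carrier G) (carrier G)"
    using aG by (simp add: bij_betw_def inj_on_cmult surj_const_mult)
  then have "bij_betw (\<lambda>x. a \<otimes> f x) (carrier G) (carrier G)"
    using bij_betw_trans[OF bij_f] by (simp add: comp_def)
  then have "(\<lambda>x\<in>carrier G. a \<otimes> f x) \<in> Bij (carrier G)"
    by (simp add: Bij_def)
  then show ?thesis
    by (simp add: quandle_auto_def Conj_def conj_central_mult[OF a])
qed

text \<open>
  Since \<open>f\<close> fixes \<open>\<one>\<close>, evaluating the affine map there yields \<open>a\<close>. Cancelling \<open>a\<close> determines \<open>f\<close> on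
  the carrier, hence everywhere because automorphisms are extensional.
\<close>

lemma (in group) inj_on_affine:
  "inj_on (\<lambda>(a, f). \<lambda>x\<in>carrier G. a \<otimes> f x) (carrier G \<times> auto G)"
proof (rule inj_onI, clarify)
  fix a f b g
  assume a: "a \<in> carrier G" and b: "b \<in> carrier G" and f: "f \<in> auto G" and g: "g \<in> auto G"
    and eq: "(\<lambda>x\<in>carrier G. a \<otimes> f x) = (\<lambda>x\<in>carrier G. b \<otimes> g x)"
  have f_hom: "f \<in> hom G G" and f_ext: "f \<in> extensional (carrier G)"
    and g_hom: "g \<in> hom G G" and g_ext: "g \<in> extensional (carrier G)"
    using f g by (auto simp: auto_def Bij_def)
  have eq_at: "a \<otimes> f x = b \<otimes> g x" if "x \<in> carrier G" for x
    using fun_cong[OF eq, of x] that by simp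
  have "a = b"
    using eq_at[of \<one>] a b hom_one[OF f_hom is_group is_group] hom_one[OF g_hom is_group is_group]
    by simp
  moreover have "f = g"
  proof (rule extensionalityI[OF f_ext g_ext])
    show "f x = g x" if "x \<in> carrier G" for x
      using eq_at[OF that] that a \<open>a = b\<close> f_hom g_hom by (simp add: hom_in_carrier)
  qed
  ultimately show "a = b \<and> f = g" ..
qed

theorem proposition4p7:
  fixes G :: "('a, 'b) monoid_scheme"
  assumes "group G"
  shows "\<exists>\<phi>. group_hom (SemidirectProduct (CenterGroup G) (AutoGroup G) (\<lambda>f a. f a))
                       (QuandleAutoGroup (Conj G)) \<phi>
           \<and> inj_on \<phi> (carrier (SemidirectProduct (CenterGroup G) (AutoGroup G) (\<lambda>f a. f a)))"
proof -
  interpret group G by fact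
  let ?S = "SemidirectProduct (CenterGroup G) (AutoGroup G) (\<lambda>f a. f a)"
  let ?Q = "QuandleAutoGroup (Conj G)"
  let ?\<phi> = "\<lambda>(a, f). \<lambda>x\<in>carrier G. a \<otimes>\<^bsub>G\<^esub> f x"
  have carrier_S: "carrier ?S = center G \<times> auto G"
    by (simp add: SemidirectProduct_def AutoGroup_simps)
  have mult_Q: "p \<otimes>\<^bsub>?Q\<^esub> q = compose (carrier G) p q"
    if "p \<in> quandle_auto (Conj G)" "q \<in> quandle_auto (Conj G)" for p q
    using that by (simp add: QuandleAutoGroup_def BijGroup_def quandle_auto_def Conj_def)
  have mult: "?\<phi> (s \<otimes>\<^bsub>?S\<^esub> t) = ?\<phi> s \<otimes>\<^bsub>?Q\<^esub> ?\<phi> t"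
    if st_in: "s \<in> carrier ?S" "t \<in> carrier ?S" for s t
  proof -
    obtain a f b g where st: "s = (a, f)" "t = (b, g)"
      and a: "a \<in> center G" and b: "b \<in> center G" and f: "f \<in> auto G" and g: "g \<in> auto G"
      using st_in unfolding carrier_S by blast
    have f_hom: "f \<in> hom G G" and g_hom: "g \<in> hom G G"
      using f g by (auto simp: auto_def)
    note aG = center_closed[OF a] and bG = center_closed[OF b]
    have "?\<phi> s \<otimes>\<^bsub>?Q\<^esub> ?\<phi> t = compose (carrier G) (?\<phi> s) (?\<phi> t)"
      using affine_quandle_auto[OF a f] affine_quandle_auto[OF b g] by (simp add: mult_Q st)
    also have "\<dots> = (\<lambda>x\<in>carrier G. a \<otimes>\<^bsub>G\<^esub> f (b \<otimes>\<^bsub>G\<^esub> g x))"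
      using bG hom_in_carrier[OF g_hom] by (auto simp: st compose_def)
    also have "\<dots> = (\<lambda>x\<in>carrier G. a \<otimes>\<^bsub>G\<^esub> f b \<otimes>\<^bsub>G\<^esub> f (g x))"
      using aG bG hom_in_carrier[OF f_hom] hom_in_carrier[OF g_hom]
      by (intro restrict_ext) (simp add: hom_mult[OF f_hom] m_assoc)
    also have "\<dots> = ?\<phi> (s \<otimes>\<^bsub>?S\<^esub> t)"
      using f g by (auto simp: st SemidirectProduct_def AutoGroup_simps compose_eq)
    finally show ?thesis ..
  qed
  have "?\<phi> \<in> hom ?S ?Q"
  proof (rule homI)
    show "?\<phi> s \<in> carrier ?Q" if "s \<in> carrier ?S" for s
      using that affine_quandle_auto by (auto simp: carrier_S QuandleAutoGroup_def)
  qed (rule mult)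
  then have "group_hom ?S ?Q ?\<phi>"
    using group_SemidirectProduct_center_auto quandle.group_QuandleAutoGroup[OF quandle_Conj]
    by (simp add: group_hom_def group_hom_axioms_def)
  moreover have "inj_on ?\<phi> (carrier ?S)"
    unfolding carrier_S by (rule inj_on_subset[OF inj_on_affine]) (auto dest: center_closed)
  ultimately show ?thesis
    by blast
qed

end
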